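(* Let $f(u)=u-u^3$. For every fixed $L>0$ and $0\le M<\frac1{\sqrt3}$, there exists a value $\lambda_1(M,L)$ such that for all $\lambda>\lambda_1(M,L)$ there is no non-constant monotone classical solution $u$ of $$\left(\frac{u_x}{\sqrt{1+u_x^2}}\right)_x+\lambda f(u)-\frac{\lambda}{L}\int_0^L f(u(x))\,dx=0,\quad x\in(0,L),\qquad u_x(0)=u_x(L)=0,\qquad \frac1L\int_0^L u(x)\,dx=M.$$
   Context: A classical solution is a solution $u\in C^2((0,L))\cap C^1([0,L])$. Here $\lambda\in(0,\infty)$. *)

theory Defs
  imports "HOL-Analysis.Analysis"
begin

text \<open>The derivative relative to \<open>[0, L]\<close>: two-sided at interior points, one-sided at \<open>0\<close> and \<open>L\<close>.\<close>

definition x_deriv :: "real \<Rightarrow> (real \<Rightarrow> real) \<Rightarrow> real \<Rightarrow> real" where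
  "x_deriv L u x = vector_derivative u (at x within {0..L})"

definition C1_closed :: "real \<Rightarrow> (real \<Rightarrow> real) \<Rightarrow> bool" where
  "C1_closed L u \<longleftrightarrow>
     u differentiable_on {0..L} \<and> continuous_on {0..L} (x_deriv L u)"

definition C2_open :: "real \<Rightarrow> (real \<Rightarrow> real) \<Rightarrow> bool" where
  "C2_open L u \<longleftrightarrow>
     u C1_differentiable_on {0<..<L} \<and> deriv u C1_differentiable_on {0<..<L}"

definition f_cubic :: "real \<Rightarrow> real" where
  "f_cubic u = u - u ^ 3"

definition classical_solution ::
  "(real \<Rightarrow> real) \<Rightarrow> real \<Rightarrow> real \<Rightarrow> real \<Rightarrow> (real \<Rightarrow> real) \<Rightarrow> bool" where
  "classical_solution f L M lam u \<longleftrightarrow>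
     C2_open L u \<and> C1_closed L u \<and>
     (\<forall>x\<in>{0<..<L}.
        deriv (\<lambda>y. x_deriv L u y / sqrt (1 + (x_deriv L u y)\<^sup>2)) x
          + lam * f (u x) - lam / L * integral {0..L} (\<lambda>y. f (u y)) = 0) \<and>
     x_deriv L u 0 = 0 \<and> x_deriv L u L = 0 \<and>
     1 / L * integral {0..L} u = M"

end

theory Submission
  imports Defs
begin

text \<open>
  Why large \<open>\<lambda>\<close> rules out monotone profiles. With \<open>s\<close> the mean of \<open>f(u)\<close> and \<open>W\<close> a primitive
  of \<open>f - s\<close>, the equation has the conserved quantity \<open>1 / sqrt (1 + u'\<^sup>2) - \<lambda> W(u)\<close>
  (\<open>first_integral\<close>). Since \<open>u'\<close> vanishes at both ends, an increasing profile running from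
  \<open>a = u 0\<close> to \<open>b = u L\<close> satisfies
  \<open>1 - 1 / sqrt (1 + u'\<^sup>2) = \<lambda> (W a - W u)\<close> and \<open>W a = W b\<close>.

  The left side lies between \<open>0\<close> and \<open>1\<close>: the slope may become large, but the curvature term can store
  only a bounded amount of energy. So \<open>W\<close> varies by at most \<open>1/\<lambda>\<close> on \<open>[a, b]\<close>. A quartic with
  fixed leading coefficient cannot be that flat on a long interval, whence
  \<open>b - a \<le> 4 \<lambda>\<^sup>-\<^sup>1\<^sup>/\<^sup>4\<close> (\<open>oscillation_bound\<close>). The mean \<open>M\<close> lies in \<open>[a, b]\<close>, so for
  large \<open>\<lambda>\<close> the whole range of \<open>u\<close> is close to \<open>M\<close>. As \<open>\<bar>M\<bar> < 1 / sqrt 3\<close>, this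
  range lies where \<open>f' = 1 - 3 u\<^sup>2\<close> is at least a constant \<open>c > 0\<close>.

  There \<open>W\<close> is uniformly convex, and the first integral gives
  \<open>u'\<^sup>2 \<ge> 2 \<lambda> (W a - W u) \<ge> \<lambda> c (u - a) (b - u)\<close>. Compare with the harmonic oscillator: the phase
  \<open>arcsin ((2 u - a - b) / (b - a))\<close> increases by \<open>\<pi>\<close> over \<open>[0, L]\<close> at a rate of at least
  \<open>sqrt (\<lambda> c)\<close>, so \<open>sqrt (\<lambda> c) L \<le> \<pi>\<close> (\<open>length_bound\<close>). This bounds \<open>\<lambda>\<close>.

  Since \<open>f\<close> is odd, \<open>-u\<close> is an increasing profile with mean \<open>-M\<close> whenever \<open>u\<close> is decreasing.
\<close>

section \<open>The tilted double-well potential\<close>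

text \<open>A primitive of \<open>f - s\<close>; the nonlocal term of the equation enters only as the tilt \<open>s\<close>.\<close>

definition tilted_potential :: "real \<Rightarrow> real \<Rightarrow> real" where
  "tilted_potential s r = r\<^sup>2 / 2 - r ^ 4 / 4 - s * r"

lemma tilted_potential_deriv:
  "(tilted_potential s has_real_derivative f_cubic r - s) (at r)"
  unfolding tilted_potential_def [abs_def] f_cubic_def
  by (auto intro!: derivative_eq_intros)

text \<open>
  A fourth difference annihilates cubics, so the tilt and the base point drop out. This is what makes
  the bound on the oscillation uniform in \<open>s\<close>.
\<close>

lemma fourth_difference_tilted_potential:
  fixes s r h :: real
  defines "D \<equiv> \<lambda>k. tilted_potential s r - tilted_potential s (r + k * h)"
  shows "D 0 - 4 * D 1 + 6 * D 2 - 4 * D 3 + D 4 = 6 * h ^ 4"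
  unfolding D_def tilted_potential_def
  by (simp add: field_simps power2_eq_square power4_eq_xxxx power3_eq_cube)

lemma tilt_of_equal_heights:
  assumes "tilted_potential s a = tilted_potential s b" and "a \<noteq> b"
  shows "s = (a + b) / 2 - (a + b) * (a\<^sup>2 + b\<^sup>2) / 4"
proof -
  have "(b - a) * s = (b\<^sup>2 - a\<^sup>2) / 2 - (b ^ 4 - a ^ 4) / 4"
    using assms(1) unfolding tilted_potential_def by argo
  also have "\<dots> = (b - a) * ((a + b) / 2 - (a + b) * (a\<^sup>2 + b\<^sup>2) / 4)"
    by (simp add: field_simps power2_eq_square power4_eq_xxxx power3_eq_cube)
  finally show ?thesis
    using assms(2) by simp
qed

text \<open>
  As a polynomial in \<open>r\<close> the gap vanishes at \<open>a\<close> and at \<open>b\<close>; the remaining factor is the second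
  divided difference of the potential at \<open>a\<close>, \<open>r\<close>, \<open>b\<close>, an average of half its second derivative.
\<close>

lemma tilted_potential_gap_factorisation:
  assumes "tilted_potential s a = tilted_potential s b" and "a \<noteq> b"
  shows "tilted_potential s a - tilted_potential s r =
    (r - a) * (b - r) * (1 / 2 - (a\<^sup>2 + r\<^sup>2 + b\<^sup>2 + a * r + r * b + a * b) / 4)"
  unfolding tilted_potential_def tilt_of_equal_heights[OF assms]
  by (simp add: field_simps power2_eq_square power4_eq_xxxx power3_eq_cube)

text \<open>
  Where the potential is strictly convex, its slope \<open>f(a) - s\<close> at an end of a chord of slope zero
  cannot vanish. Exchanging \<open>a\<close> and \<open>b\<close> gives the same at the other end.
\<close>

lemma tilt_ne_reaction:
  assumes eq: "tilted_potential s a = tilted_potential s b" and "a \<noteq> b"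
    and "3 * a\<^sup>2 < 1" and "3 * b\<^sup>2 < 1"
  shows "f_cubic a \<noteq> s"
proof -
  have "s - f_cubic a = (b - a) * (1 / 2 - (3 * a\<^sup>2 + 2 * a * b + b\<^sup>2) / 4)"
    unfolding f_cubic_def tilt_of_equal_heights[OF assms(1,2)]
    by (simp add: field_simps power2_eq_square power4_eq_xxxx power3_eq_cube)
  moreover have "2 * a * b \<le> a\<^sup>2 + b\<^sup>2"
    by (rule sum_squares_bound)
  ultimately show ?thesis
    using assms(2-4) by auto
qed

text \<open>
  Uniform convexity: \<open>W'' = 1 - 3 q\<^sup>2 \<ge> c\<close> places \<open>W\<close> below its chord at least as far as the
  parabola with second derivative \<open>c\<close>. In the factorised gap this amounts to bounding the mixed
  products by the squares.
\<close>

lemma tilted_potential_gap_lower_bound: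
  assumes "tilted_potential s a = tilted_potential s b" and "a < b"
    and r: "a \<le> r" "r \<le> b"
    and convex: "\<And>q. a \<le> q \<Longrightarrow> q \<le> b \<Longrightarrow> 3 * q\<^sup>2 \<le> 1 - c"
  shows "c / 2 * ((r - a) * (b - r)) \<le> tilted_potential s a - tilted_potential s r"
proof -
  have "a * r + r * b + a * b \<le> a\<^sup>2 + r\<^sup>2 + b\<^sup>2"
    using sum_squares_bound[of a r] sum_squares_bound[of r b] sum_squares_bound[of a b] by simp
  moreover have "3 * a\<^sup>2 \<le> 1 - c" "3 * r\<^sup>2 \<le> 1 - c" "3 * b\<^sup>2 \<le> 1 - c"
    using convex r assms(2) by auto
  ultimately have "c / 2 \<le> 1 / 2 - (a\<^sup>2 + r\<^sup>2 + b\<^sup>2 + (a * r + r * b + a * b)) / 4"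
    by argo
  then have "c / 2 \<le> 1 / 2 - (a\<^sup>2 + r\<^sup>2 + b\<^sup>2 + a * r + r * b + a * b) / 4"
    by (simp add: add.assoc)
  moreover have "0 \<le> (r - a) * (b - r)"
    using r by simp
  ultimately show ?thesis
    unfolding tilted_potential_gap_factorisation[OF assms(1) less_imp_neq[OF assms(2)]]
    by (metis mult.commute mult_right_mono)
qed

section \<open>Increasing profiles\<close>

text \<open>
  The function \<open>p\<close> stands for \<open>u'\<close> up to the boundary. The number \<open>s\<close> is left arbitrary rather than set
  to the mean of \<open>f(u)\<close>, because the end conditions on \<open>p\<close> already determine it through
  \<open>W (u 0) = W (u L)\<close>.
\<close>

locale increasing_profile =
  fixes L lam s :: real and u p :: "real \<Rightarrow> real"
  assumes L_pos: "0 < L" and lam_pos: "0 < lam"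
    and u_continuous: "continuous_on {0..L} u"
    and p_continuous: "continuous_on {0..L} p"
    and u_deriv: "\<And>x. x \<in> {0<..<L} \<Longrightarrow> (u has_real_derivative p x) (at x)"
    and flux_deriv: "\<And>x. x \<in> {0<..<L} \<Longrightarrow>
      ((\<lambda>y. p y / sqrt (1 + (p y)\<^sup>2)) has_real_derivative lam * (s - f_cubic (u x))) (at x)"
    and p_left: "p 0 = 0" and p_right: "p L = 0"
    and mono: "mono_on {0..L} u"
    and endpoints: "u 0 < u L"
begin

lemma range_bounds:
  assumes "x \<in> {0..L}"
  shows "u 0 \<le> u x" and "u x \<le> u L"
  using mono_onD[OF mono, of 0 x] mono_onD[OF mono, of x L] assms by auto

text \<open>
  Multiply the equation by \<open>u'\<close>. With \<open>v = p / sqrt (1 + p\<^sup>2)\<close> one has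
  \<open>1 / sqrt (1 + p\<^sup>2) = sqrt (1 - v\<^sup>2)\<close>, whose derivative is \<open>-p v'\<close>; written through \<open>v\<close>, the
  energy can be differentiated from \<open>flux_deriv\<close> without differentiating \<open>p\<close>.
\<close>

lemma first_integral:
  assumes x: "x \<in> {0..L}"
  shows "1 - 1 / sqrt (1 + (p x)\<^sup>2) =
    lam * (tilted_potential s (u 0) - tilted_potential s (u x))"
proof -
  define v where "v y = p y / sqrt (1 + (p y)\<^sup>2)" for y
  have pos: "0 < 1 + (p y)\<^sup>2" for y
    by (simp add: add_pos_nonneg)
  have v2: "1 - (v y)\<^sup>2 = 1 / (1 + (p y)\<^sup>2)" for y
    using pos[of y] by (simp add: v_def power_divide field_simps)
  have root: "sqrt (1 - (v y)\<^sup>2) = 1 / sqrt (1 + (p y)\<^sup>2)" for y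
    by (simp add: v2 real_sqrt_divide)
  define E where "E y = sqrt (1 - (v y)\<^sup>2) - lam * tilted_potential s (u y)" for y
  have "continuous_on {0..L} E"
    unfolding E_def root tilted_potential_def
    using pos by (intro continuous_intros u_continuous p_continuous) (auto simp: less_le)
  moreover have "(E has_real_derivative 0) (at y)" if y: "y \<in> {0<..<L}" for y
  proof -
    have dv: "(v has_real_derivative lam * (s - f_cubic (u y))) (at y)"
      using flux_deriv[OF y] unfolding v_def .
    have dW: "((\<lambda>z. tilted_potential s (u z)) has_real_derivative (f_cubic (u y) - s) * p y) (at y)"
      by (rule DERIV_chain2[OF tilted_potential_deriv u_deriv[OF y]])
    have v2pos: "0 < 1 - (v y)\<^sup>2"
      using pos[of y] by (simp add: v2)
    have vp: "v y / sqrt (1 - (v y)\<^sup>2) = p y"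
      unfolding root using pos[of y] by (simp add: v_def)
    have "(E has_real_derivative
        - (v y / sqrt (1 - (v y)\<^sup>2)) * (lam * (s - f_cubic (u y)))
        - lam * ((f_cubic (u y) - s) * p y)) (at y)"
      unfolding E_def
      by (rule derivative_eq_intros dv dW v2pos refl | use v2pos in \<open>simp add: field_simps\<close>)+
    then show ?thesis
      unfolding vp by (simp add: algebra_simps)
  qed
  ultimately have "E x = E 0"
    using DERIV_isconst2[of 0 L E x] x L_pos by auto
  then show ?thesis
    by (simp add: E_def root p_left algebra_simps)
qed

lemma potential_endpoints: "tilted_potential s (u 0) = tilted_potential s (u L)"
  using first_integral[of L] L_pos lam_pos p_right by simp

text \<open>
  All three bounds express \<open>0 \<le> 1 - 1 / sqrt (1 + p\<^sup>2) \<le> min 1 (p\<^sup>2 / 2)\<close>. The bound by \<open>1\<close> is the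
  effect of mean curvature: for the Laplacian \<open>p\<^sup>2 / 2\<close> would take the place of the left side, with
  no bound independent of the slope.
\<close>

lemma potential_gap_bounds:
  assumes x: "x \<in> {0..L}"
  shows "0 \<le> tilted_potential s (u 0) - tilted_potential s (u x)" (is "0 \<le> ?D")
    and "lam * (tilted_potential s (u 0) - tilted_potential s (u x)) \<le> 1"
    and "2 * lam * (tilted_potential s (u 0) - tilted_potential s (u x)) \<le> (p x)\<^sup>2"
proof -
  define w where "w = sqrt (1 + (p x)\<^sup>2)"
  have w: "1 \<le> w" "w\<^sup>2 = 1 + (p x)\<^sup>2"
    unfolding w_def by auto
  have eq: "1 - 1 / w = lam * ?D"
    using first_integral[OF x] by (simp add: w_def)
  have "0 \<le> lam * ?D"
    unfolding eq[symmetric] using w(1) by simp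
  then show "0 \<le> ?D"
    using lam_pos by (simp add: zero_le_mult_iff)
  show "lam * ?D \<le> 1"
    unfolding eq[symmetric] using w(1) by simp
  have "1 - 1 / w \<le> w - 1"
    using w(1) sum_squares_bound[of w 1] by (simp add: field_simps power2_eq_square)
  moreover have "2 * (w - 1) \<le> w\<^sup>2 - 1"
    using zero_le_power2[of "w - 1"] by (simp add: power2_eq_square algebra_simps)
  ultimately show "2 * lam * ?D \<le> (p x)\<^sup>2"
    using eq w(2) by argo
qed

text \<open>
  Sample the potential at five equidistant heights from \<open>u 0\<close> to \<open>u L\<close>, all attained by \<open>u\<close>. The
  gaps \<open>D k\<close> lie in \<open>[0, 1/lam]\<close> and vanish for \<open>k = 0\<close> and \<open>k = 4\<close>. As \<open>D 1\<close> and \<open>D 3\<close> have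
  negative weight, the fourth difference \<open>6 h ^ 4\<close> is at most \<open>6 * D 2\<close>.
\<close>

lemma oscillation_bound: "lam * ((u L - u 0) / 4) ^ 4 \<le> 1"
proof -
  define h where "h = (u L - u 0) / 4"
  define D where "D k = tilted_potential s (u 0) - tilted_potential s (u 0 + k * h)" for k
  have h: "0 < h" "u 0 + 4 * h = u L"
    using endpoints by (auto simp: h_def field_simps)
  have attained: "\<exists>x\<in>{0..L}. u x = u 0 + k * h" if "0 \<le> k" "k \<le> 4" for k
  proof -
    have "k * h \<le> 4 * h" "0 \<le> k * h"
      using that h(1) by auto
    then have "\<exists>x. 0 \<le> x \<and> x \<le> L \<and> u x = u 0 + k * h"
      using L_pos u_continuous h(2) by (intro IVT') auto
    then show ?thesis by auto
  qed
  have D_nonneg: "0 \<le> D k" and D_le: "lam * D k \<le> 1" if "0 \<le> k" "k \<le> 4" for k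
    using attained[OF that] potential_gap_bounds unfolding D_def by metis+
  have "D 0 - 4 * D 1 + 6 * D 2 - 4 * D 3 + D 4 = 6 * h ^ 4"
    unfolding D_def by (rule fourth_difference_tilted_potential)
  moreover have "D 0 = 0" "D 4 = 0"
    using potential_endpoints h(2) by (simp_all add: D_def)
  ultimately have "h ^ 4 \<le> D 2"
    using D_nonneg[of 1] D_nonneg[of 3] by simp
  then have "lam * h ^ 4 \<le> lam * D 2"
    using lam_pos by simp
  then show ?thesis
    using D_le[of 2] by (simp add: h_def)
qed

lemma slope_lower_bound:
  assumes x: "x \<in> {0..L}"
    and convex: "\<And>q. u 0 \<le> q \<Longrightarrow> q \<le> u L \<Longrightarrow> 3 * q\<^sup>2 \<le> 1 - c"
  shows "lam * c * ((u x - u 0) * (u L - u x)) \<le> (p x)\<^sup>2"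
proof -
  have "c / 2 * ((u x - u 0) * (u L - u x))
      \<le> tilted_potential s (u 0) - tilted_potential s (u x)"
    using range_bounds[OF x] by (intro tilted_potential_gap_lower_bound potential_endpoints
      endpoints convex)
  then have "2 * lam * (c / 2 * ((u x - u 0) * (u L - u x)))
      \<le> 2 * lam * (tilted_potential s (u 0) - tilted_potential s (u x))"
    using lam_pos by (intro mult_left_mono) auto
  then show ?thesis
    using potential_gap_bounds(3)[OF x] by simp
qed

lemma forcing_at_endpoints:
  assumes "0 < c"
    and convex: "\<And>q. u 0 \<le> q \<Longrightarrow> q \<le> u L \<Longrightarrow> 3 * q\<^sup>2 \<le> 1 - c"
  shows "f_cubic (u 0) \<noteq> s" and "f_cubic (u L) \<noteq> s"
proof -
  have sq: "3 * (u 0)\<^sup>2 < 1" "3 * (u L)\<^sup>2 < 1"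
    using convex[of "u 0"] convex[of "u L"] endpoints assms(1) by auto
  show "f_cubic (u 0) \<noteq> s"
    using tilt_ne_reaction[OF potential_endpoints _ sq] endpoints by simp
  show "f_cubic (u L) \<noteq> s"
    using tilt_ne_reaction[OF potential_endpoints[symmetric] _ sq(2,1)] endpoints by simp
qed

text \<open>
  The phase in the length bound is differentiable only where \<open>u\<close> differs from its end values. If \<open>u\<close>
  stayed at an end value on an interval, the equation there would force \<open>f(u) = s\<close>, which
  \<open>forcing_at_endpoints\<close> excludes.
\<close>

lemma interior_values:
  assumes "0 < c"
    and convex: "\<And>q. u 0 \<le> q \<Longrightarrow> q \<le> u L \<Longrightarrow> 3 * q\<^sup>2 \<le> 1 - c"
    and x: "x \<in> {0<..<L}"
  shows "u 0 < u x" and "u x < u L"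
proof -
  have plateau: "f_cubic r = s"
    if ab: "0 \<le> a" "a < b" "b \<le> L" and const: "\<And>y. y \<in> {a..b} \<Longrightarrow> u y = r" for a b r
  proof -
    define m where "m = (a + b) / 2"
    have m: "m \<in> {a<..<b}" "m \<in> {0<..<L}"
      using ab by (auto simp: m_def)
    have p0: "p y = 0" if y: "y \<in> {a<..<b}" for y
    proof -
      have "(u has_real_derivative 0) (at y)"
        by (rule has_field_derivative_transform_within_open[OF DERIV_const[of r], where S = "{a<..<b}"])
          (use y const in auto)
      moreover have "(u has_real_derivative p y) (at y)"
        using u_deriv y ab by auto
      ultimately show ?thesis
        using DERIV_unique by blast
    qed
    have "((\<lambda>y. p y / sqrt (1 + (p y)\<^sup>2)) has_real_derivative 0) (at m)"
      by (rule has_field_derivative_transform_within_open[OF DERIV_const[of 0], where S = "{a<..<b}"])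
        (use m p0 in auto)
    then have "lam * (s - f_cubic (u m)) = 0"
      using flux_deriv[OF m(2)] DERIV_unique by blast
    then show ?thesis
      using lam_pos const[of m] m by simp
  qed
  show "u 0 < u x"
  proof (rule ccontr)
    assume "\<not> u 0 < u x"
    then have const: "u y = u 0" if "y \<in> {0..x}" for y
      using mono_onD[OF mono, of y x] range_bounds(1)[of y] that x by force
    have "f_cubic (u 0) = s"
      by (rule plateau[OF _ _ _ const]) (use x in auto)
    then show False
      using forcing_at_endpoints(1)[OF assms(1,2)] by simp
  qed
  show "u x < u L"
  proof (rule ccontr)
    assume "\<not> u x < u L"
    then have const: "u y = u L" if "y \<in> {x..L}" for y
      using mono_onD[OF mono, of x y] range_bounds(2)[of y] that x by force
    have "f_cubic (u L) = s"
      by (rule plateau[OF _ _ _ const]) (use x in auto)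
    then show False
      using forcing_at_endpoints(2)[OF assms(1,2)] by simp
  qed
qed

lemma p_nonneg:
  assumes "x \<in> {0<..<L}"
  shows "0 \<le> p x"
  using mono_on_imp_deriv_nonneg[OF mono u_deriv[OF assms]] assms by simp

text \<open>
  The function \<open>t\<close> rescales \<open>u\<close> to run from \<open>-1\<close> to \<open>1\<close>, so \<open>arcsin \<circ> t\<close> gains \<open>pi\<close> over \<open>[0, L]\<close>.
  The slope bound becomes \<open>t'\<^sup>2 \<ge> lam c (1 - t\<^sup>2)\<close>, so the derivative of \<open>arcsin \<circ> t\<close> is at
  least \<open>sqrt (lam c)\<close>, and the mean value theorem compares the two.
\<close>

lemma length_bound:
  assumes "0 < c"
    and convex: "\<And>q. u 0 \<le> q \<Longrightarrow> q \<le> u L \<Longrightarrow> 3 * q\<^sup>2 \<le> 1 - c"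
  shows "sqrt (lam * c) * L \<le> pi"
proof -
  define d where "d = u L - u 0"
  define t where "t x = (2 * u x - u 0 - u L) / d" for x
  have d: "0 < d"
    using endpoints by (simp add: d_def)
  have t_range: "- 1 \<le> t x" "t x \<le> 1" if "x \<in> {0..L}" for x
    using range_bounds[OF that] d by (auto simp: t_def d_def field_simps)
  have t_interior: "- 1 < t x" "t x < 1" if "x \<in> {0<..<L}" for x
    using interior_values[OF assms that] d by (auto simp: t_def d_def field_simps)
  have t_ends: "t 0 = - 1" "t L = 1"
    using d by (auto simp: t_def d_def field_simps)
  have cont: "continuous_on {0..L} (\<lambda>x. arcsin (t x))"
    using t_range d by (intro continuous_intros) (auto simp: t_def intro!: continuous_intros u_continuous)
  have deriv: "((\<lambda>x. arcsin (t x)) has_real_derivative (2 * p x / d) / sqrt (1 - (t x)\<^sup>2)) (at x)"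
    if x: "x \<in> {0<..<L}" for x
  proof -
    have "(t has_real_derivative 2 * p x / d) (at x)"
      unfolding t_def using d by (auto intro!: derivative_eq_intros u_deriv[OF x])
    then have "((\<lambda>x. arcsin (t x)) has_real_derivative
        inverse (sqrt (1 - (t x)\<^sup>2)) * (2 * p x / d)) (at x)"
      by (rule DERIV_chain2[where f = arcsin and g = t, OF DERIV_arcsin[OF t_interior[OF x]]])
    then show ?thesis
      by (simp add: field_simps)
  qed
  have slope: "sqrt (lam * c) \<le> (2 * p x / d) / sqrt (1 - (t x)\<^sup>2)"
    if x: "x \<in> {0<..<L}" for x
  proof -
    have "1 - (t x)\<^sup>2 = 4 * ((u x - u 0) * (u L - u x)) / d\<^sup>2"
      using d by (simp add: t_def power_divide field_simps) (simp add: d_def power2_eq_square algebra_simps)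
    then have "lam * c * (1 - (t x)\<^sup>2) = 4 * (lam * c * ((u x - u 0) * (u L - u x))) / d\<^sup>2"
      by simp
    also have "\<dots> \<le> 4 * (p x)\<^sup>2 / d\<^sup>2"
      using slope_lower_bound[OF _ convex, of x] x
      by (intro divide_right_mono) auto
    also have "\<dots> = (2 * p x / d)\<^sup>2"
      by (simp add: power_divide power_mult_distrib)
    finally have "sqrt (lam * c * (1 - (t x)\<^sup>2)) \<le> 2 * p x / d"
      using p_nonneg[OF x] d by (intro real_le_lsqrt) auto
    moreover have "0 < 1 - (t x)\<^sup>2"
      using t_interior[OF x] abs_square_less_1[of "t x"] by (simp add: abs_less_iff)
    ultimately show ?thesis
      unfolding real_sqrt_mult[of "lam * c"] by (subst pos_le_divide_eq) auto
  qed
  obtain z l where z: "z \<in> {0<..<L}"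
    and l: "((\<lambda>x. arcsin (t x)) has_real_derivative l) (at z)"
    and mean_value: "arcsin (t L) - arcsin (t 0) = (L - 0) * l"
    using MVT[OF L_pos cont] deriv real_differentiable_def by (metis greaterThanLessThan_iff)
  have "l = (2 * p z / d) / sqrt (1 - (t z)\<^sup>2)"
    using DERIV_unique[OF l deriv[OF z]] .
  with mean_value have "pi = L * ((2 * p z / d) / sqrt (1 - (t z)\<^sup>2))"
    by (simp add: t_ends)
  then show ?thesis
    using mult_left_mono[OF slope[OF z], of L] L_pos by (simp add: mult.commute)
qed

lemma mean_in_range:
  assumes "integral {0..L} u = L * M"
  shows "u 0 \<le> M" and "M \<le> u L"
proof -
  have "u integrable_on {0..L}"
    by (rule integrable_continuous_interval[OF u_continuous])
  then have "integral {0..L} (\<lambda>x. u 0) \<le> integral {0..L} u"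
    and "integral {0..L} u \<le> integral {0..L} (\<lambda>x. u L)"
    using range_bounds by (auto intro!: integral_le simp del: integral_const_real)
  then show "u 0 \<le> M" "M \<le> u L"
    using assms L_pos by simp_all
qed

end

text \<open>
  The oscillation bound brings the range within \<open>d\<close> of \<open>M\<close>, the length bound then gives the
  contradiction; \<open>Lam\<close> is the larger of the two thresholds. Only \<open>M\<^sup>2\<close> enters the hypothesis, so that
  the result applies to \<open>M\<close> and to \<open>-M\<close>.
\<close>

lemma increasing_profiles_excluded:
  fixes L M :: real
  assumes "0 < L" and "3 * M\<^sup>2 < 1"
  obtains Lam where
    "\<And>lam s u p. Lam < lam \<Longrightarrow> increasing_profile L lam s u p \<Longrightarrow> integral {0..L} u \<noteq> L * M"
proof -
  (* c is half of f'(M). With \<bar>M\<bar> \<le> 1, a deviation of at most d = c / 9 <= 1 changes 3 * q^2 by at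
     most 9 * d = c, so f' >= c holds on the whole range of u. *)
  define c where "c = (1 - 3 * M\<^sup>2) / 2"
  define d where "d = c / 9"
  have c: "0 < c" and d: "0 < d" "d \<le> 1"
    unfolding c_def d_def using assms(2) zero_le_power2[of M] by argo+
  define Lam where "Lam = max ((4 / d) ^ 4) (pi\<^sup>2 / (c * L\<^sup>2))"
  show thesis
  proof (rule that[of Lam], rule notI)
    fix lam s u p
    assume lam: "Lam < lam" and "increasing_profile L lam s u p"
      and mean: "integral {0..L} u = L * M"
    interpret increasing_profile L lam s u p by fact
    have small: "u L - u 0 \<le> d"
    proof (rule ccontr)
      assume "\<not> u L - u 0 \<le> d"
      then have "(d / 4) ^ 4 \<le> ((u L - u 0) / 4) ^ 4"
        using d by (intro power_mono) auto
      then have "lam * (d / 4) ^ 4 \<le> lam * ((u L - u 0) / 4) ^ 4"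
        using lam_pos by (intro mult_left_mono) auto
      with oscillation_bound have "lam * (d / 4) ^ 4 \<le> 1"
        by simp
      moreover have "(4 / d) ^ 4 < lam"
        using lam by (simp add: Lam_def)
      ultimately show False
        using d by (simp add: field_simps)
    qed
    have convex: "3 * q\<^sup>2 \<le> 1 - c" if q: "u 0 \<le> q" "q \<le> u L" for q
    proof -
      have "\<bar>M\<bar> \<le> 1"
        using assms(2) by (intro abs_square_le_1[THEN iffD1]) simp
      moreover have diff: "\<bar>q - M\<bar> \<le> d"
        using mean_in_range[OF mean] q small by linarith
      ultimately have "\<bar>q + M\<bar> \<le> 3"
        using d by linarith
      with diff have "\<bar>q - M\<bar> * \<bar>q + M\<bar> \<le> d * 3"
        by (intro mult_mono) auto
      moreover have "q\<^sup>2 - M\<^sup>2 = (q - M) * (q + M)"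
        by algebra
      ultimately have "q\<^sup>2 - M\<^sup>2 \<le> d * 3"
        using abs_ge_self[of "(q - M) * (q + M)"] unfolding abs_mult by linarith
      then show ?thesis
        unfolding c_def d_def by argo
    qed
    have "(sqrt (lam * c) * L)\<^sup>2 \<le> pi\<^sup>2"
      using length_bound[OF c convex] lam_pos c L_pos by (intro power_mono) auto
    then have "lam * (c * L\<^sup>2) \<le> pi\<^sup>2"
      using lam_pos c by (simp add: power_mult_distrib algebra_simps)
    moreover have "pi\<^sup>2 / (c * L\<^sup>2) < lam"
      using lam by (simp add: Lam_def)
    ultimately show False
      using c L_pos by (simp add: field_simps)
  qed
qed

section \<open>From classical solutions to increasing profiles\<close>

lemma
  assumes "classical_solution f L M lam u" and "0 < L"
  shows classical_solution_continuous: "continuous_on {0..L} u"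
    and classical_solution_continuous_deriv: "continuous_on {0..L} (x_deriv L u)"
    and classical_solution_boundary: "x_deriv L u 0 = 0" "x_deriv L u L = 0"
    and classical_solution_mass: "integral {0..L} u = L * M"
  using assms unfolding classical_solution_def C1_closed_def
  by (auto simp: differentiable_imp_continuous_on field_simps)

lemma x_deriv_interior:
  assumes "x \<in> {0<..<L}"
  shows "x_deriv L u x = vector_derivative u (at x)"
  using assms unfolding x_deriv_def by (simp add: at_within_Icc_at)

lemma classical_solution_deriv:
  assumes "classical_solution f L M lam u" and x: "x \<in> {0<..<L}"
  shows "(u has_real_derivative x_deriv L u x) (at x)"
proof -
  have "u differentiable at x"
    using assms unfolding classical_solution_def C2_open_def C1_differentiable_on_eq by blast
  then show ?thesis
    unfolding x_deriv_interior[OF x] has_real_derivative_iff_has_vector_derivative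
    by (simp add: vector_derivative_works)
qed

text \<open>
  The equation speaks of \<open>deriv\<close>, a total operator that carries no information unless the flux is
  differentiable. Differentiability follows from \<open>u\<close> being \<open>C\<^sup>2\<close>, since \<open>x_deriv L u\<close> coincides with
  \<open>deriv u\<close> on the open interval.
\<close>

lemma classical_solution_flux:
  assumes sol: "classical_solution f L M lam u" and x: "x \<in> {0<..<L}"
  shows "((\<lambda>y. x_deriv L u y / sqrt (1 + (x_deriv L u y)\<^sup>2)) has_real_derivative
    lam * (1 / L * integral {0..L} (\<lambda>y. f (u y)) - f (u x))) (at x)"
proof -
  let ?flux = "\<lambda>y. x_deriv L u y / sqrt (1 + (x_deriv L u y)\<^sup>2)"
  have "deriv u differentiable at x"
    using sol x unfolding classical_solution_def C2_open_def C1_differentiable_on_eq by blast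
  then obtain q where "(deriv u has_real_derivative q) (at x)"
    unfolding real_differentiable_def by blast
  moreover have "deriv u y = x_deriv L u y" if "y \<in> {0<..<L}" for y
    by (rule DERIV_imp_deriv[OF classical_solution_deriv[OF sol that]])
  ultimately have q: "(x_deriv L u has_real_derivative q) (at x)"
    using has_field_derivative_transform_within_open[of "deriv u" q x "{0<..<L}" "x_deriv L u"] x
    by simp
  have pos: "0 < 1 + (x_deriv L u x)\<^sup>2"
    by (simp add: add_pos_nonneg)
  then have root: "((\<lambda>y. sqrt (1 + (x_deriv L u y)\<^sup>2)) has_real_derivative
      inverse (sqrt (1 + (x_deriv L u x)\<^sup>2)) / 2 * (2 * x_deriv L u x * q)) (at x)"
    by (intro DERIV_chain2[OF DERIV_real_sqrt]) (auto intro!: derivative_eq_intros q)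
  have "\<exists>D. (?flux has_real_derivative D) (at x)"
    using DERIV_divide[OF q root] pos by auto
  then have "(?flux has_real_derivative deriv ?flux x) (at x)"
    using DERIV_imp_deriv by blast
  moreover have "deriv ?flux x = lam * (1 / L * integral {0..L} (\<lambda>y. f (u y)) - f (u x))"
    using sol x unfolding classical_solution_def by (simp add: algebra_simps)
  ultimately show ?thesis
    by simp
qed

text \<open>
  The sign \<open>e = \<plusminus>1\<close> treats increasing and decreasing solutions together: \<open>f\<close> is odd, so
  multiplication by \<open>e\<close> maps solutions with tilt \<open>s\<close> to solutions with tilt \<open>e * s\<close>.
\<close>

lemma classical_solution_increasing_profile:
  assumes sol: "classical_solution f_cubic L M lam u" and "0 < L" "0 < lam"
    and sign: "e\<^sup>2 = 1" and mono: "mono_on {0..L} (\<lambda>x. e * u x)"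
    and nonconstant: "\<not> u constant_on {0..L}"
  obtains s p where "increasing_profile L lam s (\<lambda>x. e * u x) p"
proof -
  have e: "e \<noteq> 0" and odd: "f_cubic (e * r) = e * f_cubic r" for r
    using sign by (auto simp: f_cubic_def power_mult_distrib power3_eq_cube power2_eq_square
        algebra_simps)
  define s where "s = 1 / L * integral {0..L} (\<lambda>y. f_cubic (u y))"
  have "e * u 0 < e * u L"
  proof (rule ccontr)
    assume "\<not> e * u 0 < e * u L"
    have "u x = u 0" if "x \<in> {0..L}" for x
    proof -
      have "e * u 0 \<le> e * u x" "e * u x \<le> e * u L"
        using mono_onD[OF mono, of 0 x] mono_onD[OF mono, of x L] that by auto
      then have "e * u x = e * u 0"
        using \<open>\<not> e * u 0 < e * u L\<close> by linarith
      then show ?thesis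
        using e by simp
    qed
    then show False
      using nonconstant unfolding constant_on_def by blast
  qed
  moreover have "((\<lambda>y. e * x_deriv L u y / sqrt (1 + (e * x_deriv L u y)\<^sup>2)) has_real_derivative
      lam * (e * s - f_cubic (e * u x))) (at x)" if "x \<in> {0<..<L}" for x
    using DERIV_cmult[OF classical_solution_flux[OF sol that], of e] sign
    by (simp add: power_mult_distrib odd s_def algebra_simps)
  moreover have "((\<lambda>x. e * u x) has_real_derivative e * x_deriv L u x) (at x)"
    if "x \<in> {0<..<L}" for x
    using DERIV_cmult[OF classical_solution_deriv[OF sol that], of e] .
  ultimately have "increasing_profile L lam (e * s) (\<lambda>x. e * u x) (\<lambda>x. e * x_deriv L u x)"
    using assms(2,3) mono classical_solution_continuous[OF sol assms(2)]
      classical_solution_continuous_deriv[OF sol assms(2)]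
      classical_solution_boundary[OF sol assms(2)]
    by unfold_locales (auto intro!: continuous_intros)
  then show thesis
    by (rule that)
qed

theorem theorem3p3:
  fixes L M :: real
  assumes "0 < L" and "0 \<le> M" and "M < 1 / sqrt 3"
  shows "\<exists>lam1::real. \<forall>lam>lam1. 0 < lam \<longrightarrow>
    \<not> (\<exists>u. classical_solution f_cubic L M lam u \<and> \<not> u constant_on {0..L} \<and>
           (mono_on {0..L} u \<or> antimono_on {0..L} u))"
proof -
  have "M\<^sup>2 < (1 / sqrt 3)\<^sup>2"
    using assms by (intro power_strict_mono) auto
  then have M: "3 * M\<^sup>2 < 1"
    by (simp add: power_divide)
  obtain Lam where Lam:
    "\<And>lam s u p. Lam < lam \<Longrightarrow> increasing_profile L lam s u p \<Longrightarrow> integral {0..L} u \<noteq> L * M"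
    using increasing_profiles_excluded[OF assms(1) M] by blast
  obtain Lam' where Lam':
    "\<And>lam s u p. Lam' < lam \<Longrightarrow> increasing_profile L lam s u p \<Longrightarrow> integral {0..L} u \<noteq> L * (- M)"
    using increasing_profiles_excluded[OF assms(1), of "- M"] M by auto
  have False
    if lam: "max Lam Lam' < lam" "0 < lam" and sol: "classical_solution f_cubic L M lam u"
      and nonconstant: "\<not> u constant_on {0..L}"
      and monotone: "mono_on {0..L} u \<or> antimono_on {0..L} u" for lam u
    using monotone
  proof
    assume "mono_on {0..L} u"
    then obtain s p where "increasing_profile L lam s (\<lambda>x. 1 * u x) p"
      using classical_solution_increasing_profile[OF sol assms(1) lam(2), of 1] nonconstant by auto
    then show False
      using Lam[of lam s u p] lam(1) classical_solution_mass[OF sol assms(1)] by simp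
  next
    assume "antimono_on {0..L} u"
    then have "mono_on {0..L} (\<lambda>x. - 1 * u x)"
      by (simp add: monotone_on_def)
    then obtain s p where "increasing_profile L lam s (\<lambda>x. - 1 * u x) p"
      using classical_solution_increasing_profile[OF sol assms(1) lam(2), of "- 1"] nonconstant
      by auto
    then show False
      using Lam'[of lam s "\<lambda>x. - 1 * u x" p] lam(1) classical_solution_mass[OF sol assms(1)]
      by simp
  qed
  then show ?thesis
    by blast
qed

end
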